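(* For infinitely many positive integers $l$ there exists an $l$-ARS-graph.
   Context: All graphs are finite and simple. A non-edge of a graph is a pair of distinct non-adjacent vertices. $\mathcal{C}$ denotes the family of complete graphs. For a graph $J$, $\iota(J)$ is the family of graphs isomorphic to induced subgraphs of $J$. For families $\mathcal{F}_1,\mathcal{F}_2$, $\mathcal{F}_1\vee\mathcal{F}_2$ is the family of disjoint unions of a graph in $\mathcal{F}_1$ and a graph in $\mathcal{F}_2$, and $\mathcal{F}_1\wedge\mathcal{F}_2$ is the family of joins of a graph in $\mathcal{F}_1$ with a graph in $\mathcal{F}_2$. $K_1$ is the one-vertex graph, $S_3$ the edgeless graph on $3$ vertices, $C_4$ the $4$-cycle, $\bar P_3$ the complement of the $3$-vertex path. For a positive integer $l$, a graph $H$ is an $l$-ARS-graph if: (ARS1) for every $1\le s\le l$, $V(H)$ can be partitioned into $s$ stable sets and $l-s$ cliques; (ARS2) for each $\mathcal{G}\in\{\iota(K_1)\vee\mathcal{C},\ \iota(S_3)\wedge\mathcal{C},\ \iota(C_4)\wedge\mathcal{C},\ \iota(\bar P_3)\wedge\mathcal{C}\}$, $V(H)$ can be partitioned into $l-1$ cliques and a set inducing a graph in $\mathcal{G}$; (ARS3) there is a partition $\mathcal{X}_0=\{X_1,\dots,X_l\}$ of $V(H)$ such that $X_1,\dots,X_{l-2}$ are cliques, each of $H[X_{l-1}]$ and $H[X_l]$ has exactly one non-edge, and the four vertices of these two non-edges form an independent set in $H$; (ARS4) for every partition $\mathcal{X}\neq\mathcal{X}_0$ of $V(H)$ with $|\mathcal{X}|=l$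 there exists $X\in\mathcal{X}$ such that $H[X]$ has at least two non-edges. *)

theory Defs
  imports Main "HOL-Library.Multiset"
begin

definition simple_graph :: "nat set \<Rightarrow> (nat \<Rightarrow> nat \<Rightarrow> bool) \<Rightarrow> bool" where
  "simple_graph V E \<longleftrightarrow> finite V \<and>
     (\<forall>x y. E x y \<longrightarrow> x \<in> V \<and> y \<in> V \<and> x \<noteq> y) \<and> (\<forall>x y. E x y \<longrightarrow> E y x)"

definition is_clique :: "(nat \<Rightarrow> nat \<Rightarrow> bool) \<Rightarrow> nat set \<Rightarrow> bool" where
  "is_clique E X \<longleftrightarrow> (\<forall>x\<in>X. \<forall>y\<in>X. x \<noteq> y \<longrightarrow> E x y)"

definition is_stable :: "(nat \<Rightarrow> nat \<Rightarrow> bool) \<Rightarrow> nat set \<Rightarrow> bool" where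
  "is_stable E X \<longleftrightarrow> (\<forall>x\<in>X. \<forall>y\<in>X. \<not> E x y)"

definition nonedges :: "(nat \<Rightarrow> nat \<Rightarrow> bool) \<Rightarrow> nat set \<Rightarrow> nat set set" where
  "nonedges E X = {{x, y} | x y. x \<in> X \<and> y \<in> X \<and> x \<noteq> y \<and> \<not> E x y}"

definition induced_in :: "(nat \<Rightarrow> nat \<Rightarrow> bool) \<Rightarrow> nat set \<Rightarrow> nat set \<Rightarrow> (nat \<Rightarrow> nat \<Rightarrow> bool) \<Rightarrow> bool" where
  "induced_in E A VJ EJ \<longleftrightarrow> (\<exists>f. inj_on f A \<and> f ` A \<subseteq> VJ \<and>
      (\<forall>x\<in>A. \<forall>y\<in>A. E x y \<longleftrightarrow> EJ (f x) (f y)))"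

definition K1_V :: "nat set" where "K1_V = {0}"
definition K1_E :: "nat \<Rightarrow> nat \<Rightarrow> bool" where "K1_E i j = False"
definition S3_V :: "nat set" where "S3_V = {0, 1, 2}"
definition S3_E :: "nat \<Rightarrow> nat \<Rightarrow> bool" where "S3_E i j = False"
definition C4_V :: "nat set" where "C4_V = {0, 1, 2, 3}"
definition C4_E :: "nat \<Rightarrow> nat \<Rightarrow> bool" where
  "C4_E i j \<longleftrightarrow> i \<in> C4_V \<and> j \<in> C4_V \<and> (j = (i + 1) mod 4 \<or> i = (j + 1) mod 4)"
definition coP3_V :: "nat set" where "coP3_V = {0, 1, 2}"
definition coP3_E :: "nat \<Rightarrow> nat \<Rightarrow> bool" where
  "coP3_E i j \<longleftrightarrow> (i = 0 \<and> j = 2) \<or> (i = 2 \<and> j = 0)"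

text \<open>H[X] lies in F1 \<or> F2 (disjoint union) resp. F1 \<and> F2 (join), families given as
predicates on induced vertex sets (all families here are closed under isomorphism).\<close>
definition in_disj_union ::
  "((nat \<Rightarrow> nat \<Rightarrow> bool) \<Rightarrow> nat set \<Rightarrow> bool) \<Rightarrow> ((nat \<Rightarrow> nat \<Rightarrow> bool) \<Rightarrow> nat set \<Rightarrow> bool)
    \<Rightarrow> (nat \<Rightarrow> nat \<Rightarrow> bool) \<Rightarrow> nat set \<Rightarrow> bool" where
  "in_disj_union F1 F2 E X \<longleftrightarrow> (\<exists>A B. A \<inter> B = {} \<and> A \<union> B = X \<and> F1 E A \<and> F2 E B \<and>
      (\<forall>a\<in>A. \<forall>b\<in>B. \<not> E a b))"

definition in_join ::
  "((nat \<Rightarrow> nat \<Rightarrow> bool) \<Rightarrow> nat set \<Rightarrow> bool) \<Rightarrow> ((nat \<Rightarrow> nat \<Rightarrow> bool) \<Rightarrow> nat set \<Rightarrow> bool)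
    \<Rightarrow> (nat \<Rightarrow> nat \<Rightarrow> bool) \<Rightarrow> nat set \<Rightarrow> bool" where
  "in_join F1 F2 E X \<longleftrightarrow> (\<exists>A B. A \<inter> B = {} \<and> A \<union> B = X \<and> F1 E A \<and> F2 E B \<and>
      (\<forall>a\<in>A. \<forall>b\<in>B. E a b))"

definition is_partition :: "nat set \<Rightarrow> nat \<Rightarrow> (nat \<Rightarrow> nat set) \<Rightarrow> bool" where
  "is_partition V l P \<longleftrightarrow> (\<forall>i<l. P i \<subseteq> V) \<and> (\<Union>i<l. P i) = V \<and>
     (\<forall>i<l. \<forall>j<l. i \<noteq> j \<longrightarrow> P i \<inter> P j = {})"

definition ARS1 :: "nat \<Rightarrow> nat set \<Rightarrow> (nat \<Rightarrow> nat \<Rightarrow> bool) \<Rightarrow> bool" where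
  "ARS1 l V E \<longleftrightarrow> (\<forall>s. 1 \<le> s \<and> s \<le> l \<longrightarrow>
     (\<exists>P. is_partition V l P \<and> (\<forall>i<s. is_stable E (P i)) \<and>
          (\<forall>i. s \<le> i \<and> i < l \<longrightarrow> is_clique E (P i))))"

definition fam_K1_or_C :: "(nat \<Rightarrow> nat \<Rightarrow> bool) \<Rightarrow> nat set \<Rightarrow> bool" where
  "fam_K1_or_C = in_disj_union (\<lambda>E A. induced_in E A K1_V K1_E) is_clique"
definition fam_S3_and_C :: "(nat \<Rightarrow> nat \<Rightarrow> bool) \<Rightarrow> nat set \<Rightarrow> bool" where
  "fam_S3_and_C = in_join (\<lambda>E A. induced_in E A S3_V S3_E) is_clique"
definition fam_C4_and_C :: "(nat \<Rightarrow> nat \<Rightarrow> bool) \<Rightarrow> nat set \<Rightarrow> bool" where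
  "fam_C4_and_C = in_join (\<lambda>E A. induced_in E A C4_V C4_E) is_clique"
definition fam_coP3_and_C :: "(nat \<Rightarrow> nat \<Rightarrow> bool) \<Rightarrow> nat set \<Rightarrow> bool" where
  "fam_coP3_and_C = in_join (\<lambda>E A. induced_in E A coP3_V coP3_E) is_clique"

definition ARS2 :: "nat \<Rightarrow> nat set \<Rightarrow> (nat \<Rightarrow> nat \<Rightarrow> bool) \<Rightarrow> bool" where
  "ARS2 l V E \<longleftrightarrow> (\<forall>F \<in> {fam_K1_or_C, fam_S3_and_C, fam_C4_and_C, fam_coP3_and_C}.
     \<exists>P. is_partition V l P \<and> (\<forall>i. i < l - 1 \<longrightarrow> is_clique E (P i)) \<and> F E (P (l - 1)))"

definition ARS3 :: "nat \<Rightarrow> nat set \<Rightarrow> (nat \<Rightarrow> nat \<Rightarrow> bool) \<Rightarrow> (nat \<Rightarrow> nat set) \<Rightarrow> bool" where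
  "ARS3 l V E X0 \<longleftrightarrow> 2 \<le> l \<and> is_partition V l X0 \<and>
     (\<forall>i. i < l - 2 \<longrightarrow> is_clique E (X0 i)) \<and>
     (\<exists>a b c d. nonedges E (X0 (l - 2)) = {{a, b}} \<and> nonedges E (X0 (l - 1)) = {{c, d}} \<and>
        is_stable E {a, b, c, d})"

text \<open>Partitions are compared as multisets of parts (index order is irrelevant).\<close>
definition ARS4 :: "nat \<Rightarrow> nat set \<Rightarrow> (nat \<Rightarrow> nat \<Rightarrow> bool) \<Rightarrow> (nat \<Rightarrow> nat set) \<Rightarrow> bool" where
  "ARS4 l V E X0 \<longleftrightarrow> (\<forall>P. is_partition V l P \<and>
       mset (map P [0..<l]) \<noteq> mset (map X0 [0..<l]) \<longrightarrow>
     (\<exists>i<l. 2 \<le> card (nonedges E (P i))))"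

definition ARS_graph :: "nat \<Rightarrow> nat set \<Rightarrow> (nat \<Rightarrow> nat \<Rightarrow> bool) \<Rightarrow> bool" where
  "ARS_graph l V E \<longleftrightarrow> 0 < l \<and> simple_graph V E \<and> ARS1 l V E \<and> ARS2 l V E \<and>
     (\<exists>X0. ARS3 l V E X0 \<and> ARS4 l V E X0)"

end

theory Submission
  imports Defs
begin

text \<open>Adding a disjoint triangle turns an \<open>l\<close>-ARS-graph whose parts in the partition of (ARS3) have
  at least three vertices into an \<open>(l+1)\<close>-ARS-graph with the same property. For (ARS4), let a partition
  into \<open>l + 1\<close> parts with at most one non-edge each be given. A part meeting both the triangle and the
  old graph consists of one vertex of each. If some part lies inside the triangle, the traces of the
  other parts on the old graph form a partition into \<open>l\<close> parts, which must be the distinguished one,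
  and its parts are too large to be mixed. Otherwise there are two mixed parts; merging the traces of
  these two gives a partition of the old graph into \<open>l\<close> parts one of which has only two vertices,
  which is impossible. It remains to exhibit one such graph for \<open>l = 4\<close>; it has 15 vertices, and
  its uniqueness property is checked by backtracking.\<close>

subsection \<open>Non-edges and partitions\<close>

lemma finite_nonedges: "finite X \<Longrightarrow> finite (nonedges E X)"
  by (rule finite_subset[of _ "Pow X"]) (auto simp: nonedges_def)

lemma nonedges_mono: "X \<subseteq> Y \<Longrightarrow> nonedges E X \<subseteq> nonedges E Y"
  unfolding nonedges_def by blast

lemma nonedges_cong:
  "(\<And>x y. x \<in> X \<Longrightarrow> y \<in> X \<Longrightarrow> E x y = E' x y) \<Longrightarrow> nonedges E X = nonedges E' X"
  unfolding nonedges_def by blast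

lemma card_nonedges_mono: "finite Y \<Longrightarrow> X \<subseteq> Y \<Longrightarrow> card (nonedges E X) \<le> card (nonedges E Y)"
  by (simp add: card_mono finite_nonedges nonedges_mono)

text \<open>Applied to two cross pairs sharing a vertex, this bounds the trace of a mixed part on
  either side by one vertex.\<close>

lemma card_nonedges_le_1_unique:
  assumes "finite X" "card (nonedges E X) \<le> 1"
    and "x \<in> X" "y \<in> X" "x \<noteq> y" "\<not> E x y" "x' \<in> X" "y' \<in> X" "x' \<noteq> y'" "\<not> E x' y'"
  shows "{x, y} = {x', y'}"
proof -
  have "{x, y} \<in> nonedges E X" "{x', y'} \<in> nonedges E X"
    using assms unfolding nonedges_def by blast+
  then show ?thesis
    using assms(2) card_le_Suc0_iff_eq[OF finite_nonedges[OF assms(1)], of E] by auto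
qed

lemma card_nonedges_doubleton: "card (nonedges E {x, y}) \<le> 1"
proof -
  have "nonedges E {x, y} \<subseteq> {{x, y}}"
    unfolding nonedges_def by auto
  then show ?thesis
    using card_mono[of "{{x, y}}"] by fastforce
qed

lemma is_partition_ex1:
  assumes "is_partition V l P" "x \<in> V"
  shows "\<exists>!i. i < l \<and> x \<in> P i"
proof -
  obtain i where "i < l" "x \<in> P i"
    using assms unfolding is_partition_def by auto
  then show ?thesis
    using assms(1) unfolding is_partition_def by (intro ex1I[of _ i]) (simp, metis disjoint_iff)
qed

lemma is_partitionI:
  assumes "\<And>i. i < l \<Longrightarrow> P i \<subseteq> V" "\<And>x. x \<in> V \<Longrightarrow> \<exists>i<l. x \<in> P i"
    and "\<And>i j x. i < l \<Longrightarrow> j < l \<Longrightarrow> x \<in> P i \<Longrightarrow> x \<in> P j \<Longrightarrow> i = j"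
  shows "is_partition V l P"
  unfolding is_partition_def
proof (intro conjI)
  show "(\<Union>i<l. P i) = V"
    using assms(1,2) by blast
  show "\<forall>i<l. \<forall>j<l. i \<noteq> j \<longrightarrow> P i \<inter> P j = {}"
    using assms(3) by (meson disjoint_iff)
qed (use assms(1) in simp)

section \<open>Invariance when two adjacency relations agree on the set\<close>

lemma induced_in_cong:
  "(\<And>x y. x \<in> A \<Longrightarrow> y \<in> A \<Longrightarrow> E x y = E' x y) \<Longrightarrow> induced_in E A VJ EJ = induced_in E' A VJ EJ"
  unfolding induced_in_def by (intro ex_cong1) auto

lemma is_clique_cong:
  "(\<And>x y. x \<in> A \<Longrightarrow> y \<in> A \<Longrightarrow> E x y = E' x y) \<Longrightarrow> is_clique E A = is_clique E' A"
  unfolding is_clique_def by auto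

lemma in_disj_union_cong:
  assumes "\<And>A. A \<subseteq> X \<Longrightarrow> F1 E A = F1 E' A" "\<And>A. A \<subseteq> X \<Longrightarrow> F2 E A = F2 E' A"
    and "\<And>x y. x \<in> X \<Longrightarrow> y \<in> X \<Longrightarrow> E x y = E' x y"
  shows "in_disj_union F1 F2 E X = in_disj_union F1 F2 E' X"
proof -
  have "(A \<inter> B = {} \<and> A \<union> B = X \<and> F1 E A \<and> F2 E B \<and> (\<forall>a\<in>A. \<forall>b\<in>B. \<not> E a b)) \<longleftrightarrow>
      (A \<inter> B = {} \<and> A \<union> B = X \<and> F1 E' A \<and> F2 E' B \<and> (\<forall>a\<in>A. \<forall>b\<in>B. \<not> E' a b))" for A B
  proof (cases "A \<union> B = X")
    case True
    then have "(\<forall>a\<in>A. \<forall>b\<in>B. \<not> E a b) \<longleftrightarrow> (\<forall>a\<in>A. \<forall>b\<in>B. \<not> E' a b)"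
      using assms(3) by (metis UnCI)
    then show ?thesis
      using True assms(1)[of A] assms(2)[of B] by auto
  qed simp
  then show ?thesis
    unfolding in_disj_union_def by simp
qed

lemma in_join_cong:
  assumes "\<And>A. A \<subseteq> X \<Longrightarrow> F1 E A = F1 E' A" "\<And>A. A \<subseteq> X \<Longrightarrow> F2 E A = F2 E' A"
    and "\<And>x y. x \<in> X \<Longrightarrow> y \<in> X \<Longrightarrow> E x y = E' x y"
  shows "in_join F1 F2 E X = in_join F1 F2 E' X"
proof -
  have "(A \<inter> B = {} \<and> A \<union> B = X \<and> F1 E A \<and> F2 E B \<and> (\<forall>a\<in>A. \<forall>b\<in>B. E a b)) \<longleftrightarrow>
      (A \<inter> B = {} \<and> A \<union> B = X \<and> F1 E' A \<and> F2 E' B \<and> (\<forall>a\<in>A. \<forall>b\<in>B. E' a b))" for A B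
  proof (cases "A \<union> B = X")
    case True
    then have "(\<forall>a\<in>A. \<forall>b\<in>B. E a b) \<longleftrightarrow> (\<forall>a\<in>A. \<forall>b\<in>B. E' a b)"
      using assms(3) by (metis UnCI)
    then show ?thesis
      using True assms(1)[of A] assms(2)[of B] by auto
  qed simp
  then show ?thesis
    unfolding in_join_def by simp
qed

text \<open>Carries the exceptional part of (ARS2) over to the enlarged graph: that part lies in the
  old vertex set, where both adjacency relations agree.\<close>

lemma fam_cong:
  assumes "\<And>x y. x \<in> X \<Longrightarrow> y \<in> X \<Longrightarrow> E x y = E' x y"
    and "F \<in> {fam_K1_or_C, fam_S3_and_C, fam_C4_and_C, fam_coP3_and_C}"
  shows "F E X = F E' X"
proof -
  have ind: "induced_in E A VJ EJ = induced_in E' A VJ EJ" if "A \<subseteq> X" for A VJ EJ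
    using that assms(1) by (intro induced_in_cong) auto
  have clq: "is_clique E A = is_clique E' A" if "A \<subseteq> X" for A
    using that assms(1) by (intro is_clique_cong) auto
  show ?thesis
    using assms(2) unfolding fam_K1_or_C_def fam_S3_and_C_def fam_C4_and_C_def fam_coP3_and_C_def
    by (auto simp: in_disj_union_cong[where E=E and E'=E', OF ind clq assms(1)]
        in_join_cong[where E=E and E'=E', OF ind clq assms(1)])
qed

subsection \<open>Adding a disjoint triangle\<close>

definition add_clique :: "(nat \<Rightarrow> nat \<Rightarrow> bool) \<Rightarrow> nat set \<Rightarrow> nat \<Rightarrow> nat \<Rightarrow> bool" where
  "add_clique E S x y \<longleftrightarrow> E x y \<or> x \<in> S \<and> y \<in> S \<and> x \<noteq> y"

text \<open>The bound 3 is the invariant of the induction on \<open>l\<close>: the trace of a mixed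
  part has one old vertex, two merged traces have two, so neither fits the distinguished
  partition.\<close>

definition large_ARS_graph :: "nat \<Rightarrow> nat set \<Rightarrow> (nat \<Rightarrow> nat \<Rightarrow> bool) \<Rightarrow> bool" where
  "large_ARS_graph l V E \<longleftrightarrow> simple_graph V E \<and> ARS1 l V E \<and> ARS2 l V E \<and>
     (\<exists>X0. ARS3 l V E X0 \<and> ARS4 l V E X0 \<and> (\<forall>i<l. 3 \<le> card (X0 i)))"

locale disjoint_clique =
  fixes V :: "nat set" and E :: "nat \<Rightarrow> nat \<Rightarrow> bool" and S :: "nat set"
  assumes graph: "simple_graph V E" and finS: "finite S" and disj: "V \<inter> S = {}"
begin

abbreviation "E' \<equiv> add_clique E S"

lemma finV: "finite V"
  using graph unfolding simple_graph_def by auto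

lemma E_in_V: "E x y \<Longrightarrow> x \<in> V \<and> y \<in> V"
  using graph unfolding simple_graph_def by auto

lemma E'_on_V: "x \<in> V \<Longrightarrow> y \<in> V \<Longrightarrow> E x y = E' x y"
  using disj unfolding add_clique_def by auto

lemma not_E'_V_S: "x \<in> V \<Longrightarrow> y \<in> S \<Longrightarrow> \<not> E' x y" "x \<in> V \<Longrightarrow> y \<in> S \<Longrightarrow> \<not> E' y x"
  using disj E_in_V unfolding add_clique_def by auto

lemma not_E'_refl: "\<not> E' x x"
  using graph unfolding add_clique_def simple_graph_def by auto

lemma simple_graph_add_clique: "simple_graph (V \<union> S) E'"
  using graph finS unfolding simple_graph_def add_clique_def by auto

lemma is_clique_S: "is_clique E' S"
  unfolding is_clique_def add_clique_def by auto

lemma is_clique_on_V: "X \<subseteq> V \<Longrightarrow> is_clique E' X = is_clique E X"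
  using E'_on_V by (intro is_clique_cong) auto

lemma nonedges_on_V: "X \<subseteq> V \<Longrightarrow> nonedges E' X = nonedges E X"
  using E'_on_V by (intro nonedges_cong) auto

text \<open>The new part goes to the front because (ARS2) and (ARS3) single out the last parts;
  \<open>is_partition_Suc_l\<close> puts it at the end for (ARS1), where the stable sets come
  first.\<close>

lemma is_partition_Suc_0:
  assumes "is_partition V l P"
  shows "is_partition (V \<union> S) (Suc l) (case_nat S P)"
proof (rule is_partitionI)
  have sub: "P i \<subseteq> V" if "i < l" for i
    using assms that unfolding is_partition_def by auto
  show "case_nat S P i \<subseteq> V \<union> S" if "i < Suc l" for i
    using that sub by (cases i) auto
  show "\<exists>i<Suc l. x \<in> case_nat S P i" if x: "x \<in> V \<union> S" for x
  proof (cases "x \<in> S")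
    case False
    then obtain i where "i < l" "x \<in> P i"
      using is_partition_ex1[OF assms, of x] x by blast
    then show ?thesis by (intro exI[of _ "Suc i"]) auto
  qed (intro exI[of _ 0], auto)
  show "i = j" if "i < Suc l" "j < Suc l" "x \<in> case_nat S P i" "x \<in> case_nat S P j" for i j x
  proof (cases "x \<in> S")
    case True
    then show ?thesis using that sub disj by (cases i; cases j) auto
  next
    case False
    then have "x \<in> V" using that sub by (cases i) auto
    then show ?thesis
      using False that is_partition_ex1[OF assms, of x] by (cases i; cases j) auto
  qed
qed

lemma is_partition_Suc_l:
  assumes "is_partition V l P"
  shows "is_partition (V \<union> S) (Suc l) (P(l := S))"
  using assms disj unfolding is_partition_def
  by (auto simp: less_Suc_eq)

text \<open>For \<open>s \<le> l\<close> the clique \<open>S\<close> is appended as one more clique.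
  For \<open>s = Suc l\<close> the vertices of \<open>S\<close> are spread one by one over the
  \<open>l\<close> stable sets and one further set; stability survives since no edge joins
  \<open>V\<close> and \<open>S\<close>.\<close>

lemma ARS1_Suc:
  assumes "ARS1 l V E" "0 < l" "card S \<le> Suc l"
  shows "ARS1 (Suc l) (V \<union> S) E'"
  unfolding ARS1_def
proof (intro allI impI)
  fix s assume s: "1 \<le> s \<and> s \<le> Suc l"
  show "\<exists>P. is_partition (V \<union> S) (Suc l) P \<and> (\<forall>i<s. is_stable E' (P i)) \<and>
         (\<forall>i. s \<le> i \<and> i < Suc l \<longrightarrow> is_clique E' (P i))"
  proof (cases "s \<le> l")
    case True
    then obtain P where P: "is_partition V l P" "\<forall>i<s. is_stable E (P i)"
        "\<forall>i. s \<le> i \<and> i < l \<longrightarrow> is_clique E (P i)"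
      using assms(1) s unfolding ARS1_def by blast
    have sub: "P i \<subseteq> V" if "i < l" for i
      using P(1) that unfolding is_partition_def by auto
    have "is_stable E' (P i)" if "i < s" for i
      using P(2) sub[of i] E'_on_V that True unfolding is_stable_def by (meson order_less_le_trans subsetD)
    moreover have "is_clique E' ((P(l := S)) i)" if "s \<le> i" "i < Suc l" for i
      using that P(3) sub[of i] is_clique_on_V is_clique_S by auto
    ultimately show ?thesis
      using is_partition_Suc_l[OF P(1)] True by (intro exI[of _ "P(l := S)"]) auto
  next
    case False
    then have [simp]: "s = Suc l" using s by auto
    obtain P where P: "is_partition V l P" "\<forall>i<l. is_stable E (P i)"
      using assms(1,2) unfolding ARS1_def by (metis Suc_leI One_nat_def order_refl)
    obtain f where f: "bij_betw f {0..<card S} S"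
      using ex_bij_betw_nat_finite[OF finS] by blast
    \<comment> \<open>Index \<open>l\<close> carries no old part: it gets \<open>f l\<close> if
      \<open>card S = Suc l\<close> and is empty otherwise.\<close>
    define Q where "Q i = (if i < l then P i else {}) \<union> (if i < card S then {f i} else {})" for i
    have fS: "f i \<in> S" if "i < card S" for i
      using f that by (auto simp: bij_betw_def)
    have PV: "P i \<subseteq> V" if "i < l" for i
      using P(1) that unfolding is_partition_def by auto
    have "is_partition (V \<union> S) (Suc l) Q"
    proof (rule is_partitionI)
      show "Q i \<subseteq> V \<union> S" for i
        using fS PV unfolding Q_def by auto
    next
      fix x assume "x \<in> V \<union> S"
      then show "\<exists>i<Suc l. x \<in> Q i"
      proof
        assume "x \<in> V"
        then obtain i where "i < l" "x \<in> P i"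
          using is_partition_ex1[OF P(1)] by blast
        then show ?thesis unfolding Q_def by (intro exI[of _ i]) auto
      next
        assume "x \<in> S"
        then obtain i where "i < card S" "f i = x"
          using f unfolding bij_betw_def by force
        then show ?thesis using assms(3) unfolding Q_def by (intro exI[of _ i]) auto
      qed
    next
      fix i j x assume x: "x \<in> Q i" "x \<in> Q j"
      show "i = j"
      proof (cases "x \<in> V")
        case True
        then have "i < l \<and> x \<in> P i" "j < l \<and> x \<in> P j"
          using x fS disj unfolding Q_def by (auto split: if_splits)
        then show ?thesis using is_partition_ex1[OF P(1) True] by blast
      next
        case False
        then have "i < card S \<and> x = f i" "j < card S \<and> x = f j"
          using x PV unfolding Q_def by (auto split: if_splits)
        then show ?thesis using f by (auto simp: bij_betw_def inj_on_def)
      qed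
    qed
    moreover have "is_stable E' (Q i)" for i
      unfolding is_stable_def
    proof (intro ballI)
      fix x y assume xy: "x \<in> Q i" "y \<in> Q i"
      consider "x \<in> V" "y \<in> V" | "x \<in> V" "y \<in> S" | "x \<in> S" "y \<in> V" | "x = y"
        using xy PV[of i] fS[of i] unfolding Q_def by (auto split: if_splits)
      then show "\<not> E' x y"
      proof cases
        case 1
        then have "i < l" "x \<in> P i" "y \<in> P i"
          using xy fS disj unfolding Q_def by (auto split: if_splits)
        then show ?thesis using P(2) E'_on_V[OF 1] unfolding is_stable_def by auto
      qed (use not_E'_V_S not_E'_refl in auto)
    qed
    ultimately show ?thesis by (intro exI[of _ Q]) auto
  qed
qed

lemma ARS2_Suc:
  assumes "ARS2 l V E" "0 < l"
  shows "ARS2 (Suc l) (V \<union> S) E'"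
  unfolding ARS2_def
proof
  fix F assume F: "F \<in> {fam_K1_or_C, fam_S3_and_C, fam_C4_and_C, fam_coP3_and_C}"
  then obtain P where P: "is_partition V l P" "\<forall>i. i < l - 1 \<longrightarrow> is_clique E (P i)" "F E (P (l - 1))"
    using assms(1) unfolding ARS2_def by blast
  have sub: "P i \<subseteq> V" if "i < l" for i
    using P(1) that unfolding is_partition_def by auto
  have "is_clique E' (case_nat S P i)" if "i < Suc l - 1" for i
    using that P(2) sub is_clique_on_V is_clique_S by (cases i) auto
  moreover have "F E' (P (l - 1))"
    using fam_cong[OF _ F, of "P (l - 1)" E E'] P(3) sub[of "l - 1"] E'_on_V assms(2) by auto
  then have "F E' (case_nat S P (Suc l - 1))"
    using assms(2) by (cases l) auto
  ultimately show "\<exists>P. is_partition (V \<union> S) (Suc l) P \<and> (\<forall>i<Suc l - 1. is_clique E' (P i)) \<and>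
      F E' (P (Suc l - 1))"
    using is_partition_Suc_0[OF P(1)] by (intro exI[of _ "case_nat S P"]) auto
qed

lemma ARS3_Suc:
  assumes "ARS3 l V E X0"
  shows "ARS3 (Suc l) (V \<union> S) E' (case_nat S X0)"
proof -
  obtain m where [simp]: "l = Suc (Suc m)"
    using assms unfolding ARS3_def by (metis add_2_eq_Suc le_Suc_ex)
  obtain a b c d where *: "is_partition V l X0" "\<forall>i<m. is_clique E (X0 i)"
      "nonedges E (X0 m) = {{a, b}}" "nonedges E (X0 (Suc m)) = {{c, d}}" "is_stable E {a, b, c, d}"
    using assms unfolding ARS3_def by auto
  have sub: "X0 i \<subseteq> V" if "i < l" for i
    using *(1) that unfolding is_partition_def by auto
  \<comment> \<open>The four vertices lie in \<open>V\<close>, where the two adjacency relations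
    agree, so their stability carries over.\<close>
  have "{a, b} \<in> nonedges E (X0 m)" "{c, d} \<in> nonedges E (X0 (Suc m))"
    using * by auto
  then have "{a, b} \<subseteq> X0 m" "{c, d} \<subseteq> X0 (Suc m)"
    unfolding nonedges_def by (smt (verit) mem_Collect_eq insert_subset empty_subsetI)+
  then have "{a, b, c, d} \<subseteq> V"
    using sub[of m] sub[of "Suc m"] by auto
  then have "is_stable E' {a, b, c, d}"
    using *(5) E'_on_V unfolding is_stable_def by (meson subsetD)
  moreover have "is_clique E' (case_nat S X0 i)" if "i < Suc m" for i
    using that *(2) sub is_clique_on_V is_clique_S by (cases i) auto
  ultimately show ?thesis
    using * sub is_partition_Suc_0[OF *(1)] nonedges_on_V unfolding ARS3_def by auto
qed

text \<open>The two cases of the argument (a part \<open>P k\<close> inside \<open>S\<close>, or two mixed parts \<open>P k\<close> and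
  \<open>P m\<close>) are treated uniformly: the trace of \<open>P k\<close> is moved into part \<open>m\<close> and part \<open>k\<close> is dropped.\<close>

lemma ARS4_Suc:
  assumes ars4: "ARS4 l V E X0" and big: "\<forall>i<l. 3 \<le> card (X0 i)" and "0 < l" "2 \<le> card S"
  shows "ARS4 (Suc l) (V \<union> S) E' (case_nat S X0)"
  unfolding ARS4_def
proof (intro allI impI, elim conjE, rule ccontr)
  fix P
  assume part: "is_partition (V \<union> S) (Suc l) P"
    and neq: "mset (map P [0..<Suc l]) \<noteq> mset (map (case_nat S X0) [0..<Suc l])"
    and "\<not> (\<exists>i<Suc l. 2 \<le> card (nonedges E' (P i)))"
  then have few: "card (nonedges E' (P i)) \<le> 1" if "i < Suc l" for i
    using that by force
  have sub: "P i \<subseteq> V \<union> S" if "i < Suc l" for i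
    using part that unfolding is_partition_def by auto
  have fin: "finite (P i)" if "i < Suc l" for i
    using sub[OF that] finV finS by (meson finite_UnI finite_subset)
  \<comment> \<open>The pairs of \<open>x\<close> with \<open>y\<close> and with \<open>z\<close>
    are both non-edges of one part, hence equal.\<close>
  have mixed_V: "y = z" if "i < Suc l" "x \<in> P i \<inter> S" "y \<in> P i \<inter> V" "z \<in> P i \<inter> V" for i x y z
    using card_nonedges_le_1_unique[OF fin few, of i x y x z] that disj not_E'_V_S by (auto simp: doubleton_eq_iff)
  have mixed_S: "x = x'" if "i < Suc l" "x \<in> P i \<inter> S" "x' \<in> P i \<inter> S" "y \<in> P i \<inter> V" for i x x' y
    using card_nonedges_le_1_unique[OF fin few, of i x y x' y] that disj not_E'_V_S by (auto simp: doubleton_eq_iff)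
  \<comment> \<open>Contrapositive of (ARS4) for the old graph.\<close>
  have reduce: "mset (map P' [0..<l]) = mset (map X0 [0..<l])"
    if "is_partition V l P'" "\<forall>i<l. card (nonedges E (P' i)) \<le> 1" for P'
    using ars4 that unfolding ARS4_def by force
  have large: "3 \<le> card (P' i)" if eq: "mset (map P' [0..<l]) = mset (map X0 [0..<l])" and i: "i < l" for P' i
  proof -
    have "set (map P' [0..<l]) = set (map X0 [0..<l])"
      using eq by (rule mset_eq_setD)
    then have "P' ` {0..<l} = X0 ` {0..<l}" by simp
    then have "P' i \<in> X0 ` {0..<l}" using i by (metis atLeastLessThan_iff imageI zero_le)
    then obtain j where "j < l" "P' i = X0 j" by auto
    then show ?thesis using big by simp
  qed
  \<comment> \<open>\<open>g\<close> numbers the parts other than \<open>P k\<close> by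
    \<open>0..<l\<close>. Only part \<open>m\<close> may gain non-edges by the move, hence the
    hypothesis on \<open>Q m\<close>.\<close>
  have main: "mset (map (Q \<circ> g) [0..<l]) = mset (map X0 [0..<l])"
    if km: "k < Suc l" "m < Suc l" "k \<noteq> m"
      and g: "bij_betw g {0..<l} ({0..<Suc l} - {k})"
      and Q: "\<And>i. Q i = (P i \<inter> V) \<union> (if i = m then P k \<inter> V else {})"
      and card: "card (nonedges E (Q m)) \<le> 1"
    for k m g Q
  proof (rule reduce)
    have gl: "g i < Suc l \<and> g i \<noteq> k" if "i < l" for i
      using bij_betwE[OF g] that by auto
    have ginv: "\<exists>j<l. g j = i" if "i < Suc l" "i \<noteq> k" for i
    proof -
      have "i \<in> g ` {0..<l}" using g that by (auto simp: bij_betw_def)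
      then show ?thesis by auto
    qed
    show "is_partition V l (Q \<circ> g)"
    proof (rule is_partitionI)
      show "(Q \<circ> g) i \<subseteq> V" for i using Q by auto
    next
      fix x assume x: "x \<in> V"
      then obtain i where i: "i < Suc l" "x \<in> P i"
        using is_partition_ex1[OF part, of x] by blast
      show "\<exists>i<l. x \<in> (Q \<circ> g) i"
      proof (cases "i = k")
        case True
        then show ?thesis using ginv[of m] km Q x i by fastforce
      next
        case False
        then show ?thesis using ginv[of i] Q x i by fastforce
      qed
    next
      fix i j x assume ij: "i < l" "j < l" "x \<in> (Q \<circ> g) i" "x \<in> (Q \<circ> g) j"
      then have x: "x \<in> V" using Q by (auto split: if_splits)
      then have uniq: "\<And>u v. u < Suc l \<Longrightarrow> v < Suc l \<Longrightarrow> x \<in> P u \<Longrightarrow> x \<in> P v \<Longrightarrow> u = v"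
        using is_partition_ex1[OF part, of x] by blast
      have "g i = g j"
        using ij gl[of i] gl[of j] uniq km Q by (auto split: if_splits)
      then show "i = j" using g ij by (auto simp: bij_betw_def inj_on_def)
    qed
    show "\<forall>i<l. card (nonedges E ((Q \<circ> g) i)) \<le> 1"
    proof (intro allI impI)
      fix i assume i: "i < l"
      show "card (nonedges E ((Q \<circ> g) i)) \<le> 1"
      proof (cases "g i = m")
        case False
        then have "(Q \<circ> g) i = P (g i) \<inter> V" using Q by auto
        moreover have "card (nonedges E' (P (g i) \<inter> V)) \<le> card (nonedges E' (P (g i)))"
          using gl[OF i] fin by (intro card_nonedges_mono) auto
        ultimately show ?thesis
          using few[of "g i"] gl[OF i] nonedges_on_V[of "P (g i) \<inter> V"] by auto
      qed (use card in auto)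
    qed
  qed
  have bij: "\<exists>g. bij_betw g {0..<l} ({0..<Suc l} - {k})" if "k < Suc l" for k
    using ex_bij_betw_nat_finite[of "{0..<Suc l} - {k}"] that by simp
  show False
  proof (cases "\<exists>k<Suc l. P k \<subseteq> S")
    case True
    then obtain k where k: "k < Suc l" "P k \<subseteq> S" by auto
    \<comment> \<open>\<open>m\<close> is a formal target: \<open>P k\<close> has empty trace on
      \<open>V\<close>, so any other index will do.\<close>
    obtain m where m: "m < Suc l" "k \<noteq> m"
      using \<open>0 < l\<close> by (metis Suc_less_eq less_Suc_eq_0_disj neq0_conv)
    obtain g where g: "bij_betw g {0..<l} ({0..<Suc l} - {k})"
      using bij[OF k(1)] by blast
    have PkV: "P k \<inter> V = {}" using k(2) disj by auto
    have gl: "g i < Suc l" if "i < l" for i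
      using bij_betwE[OF g] that by auto
    have "card (nonedges E (P m \<inter> V)) \<le> 1"
      using card_nonedges_mono[OF fin[OF m(1)], of "P m \<inter> V" E'] few[OF m(1)]
        nonedges_on_V[of "P m \<inter> V"] by auto
    then have eq: "mset (map ((\<lambda>i. P i \<inter> V) \<circ> g) [0..<l]) = mset (map X0 [0..<l])"
      using main[OF k(1) m g, of "\<lambda>i. P i \<inter> V"] PkV by auto
    \<comment> \<open>A part meeting \<open>S\<close> would have a trace of at most one vertex,
      whereas the parts of \<open>X0\<close> have at least three.\<close>
    have PgV: "P (g i) \<subseteq> V" if i: "i < l" for i
    proof -
      have c: "3 \<le> card (P (g i) \<inter> V)"
        using large[OF eq i] by simp
      have "P (g i) \<inter> S = {}"
      proof (rule ccontr)
        assume "P (g i) \<inter> S \<noteq> {}"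
        then obtain x where "x \<in> P (g i) \<inter> S" by blast
        then have "card (P (g i) \<inter> V) \<le> 1"
          using mixed_V[OF gl[OF i]] fin[OF gl[OF i]] by (metis One_nat_def card_le_Suc0_iff_eq finite_Int)
        with c show False by simp
      qed
      then show ?thesis using sub[OF gl[OF i]] by blast
    qed
    \<comment> \<open>All other parts lie in \<open>V\<close>, so the whole of \<open>S\<close>
      falls to \<open>P k\<close>.\<close>
    have "S \<subseteq> P k"
    proof
      fix x assume x: "x \<in> S"
      then obtain i where i: "i < Suc l" "x \<in> P i"
        using is_partition_ex1[OF part, of x] by blast
      have "i = k"
      proof (rule ccontr)
        assume "i \<noteq> k"
        then have "i \<in> g ` {0..<l}" using bij_betw_imp_surj_on[OF g] i by simp
        then obtain j where "j < l" "g j = i" by auto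
        then show False using PgV x i disj by blast
      qed
      then show "x \<in> P k" using i by simp
    qed
    then have PkS: "P k = S" using k by auto
    \<comment> \<open>Splitting off index \<open>k\<close> and renumbering the rest by
      \<open>g\<close> shows that the parts of \<open>P\<close> are \<open>S\<close> and those of
      \<open>X0\<close>, contradicting \<open>neq\<close>.\<close>
    have "mset (map P [0..<Suc l]) = image_mset P (mset_set {0..<Suc l})"
      by (simp del: upt_Suc)
    also have "mset_set {0..<Suc l} = add_mset k (mset_set ({0..<Suc l} - {k}))"
      using k(1) by (intro mset_set.remove) auto
    also have "mset_set ({0..<Suc l} - {k}) = image_mset g (mset_set {0..<l})"
      using g by (simp add: bij_betw_def image_mset_mset_set)
    also have "image_mset P (add_mset k (image_mset g (mset_set {0..<l})))
        = add_mset S (mset (map (P \<circ> g) [0..<l]))"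
      using PkS by (simp add: multiset.map_comp comp_def)
    also have "map (P \<circ> g) [0..<l] = map ((\<lambda>i. P i \<inter> V) \<circ> g) [0..<l]"
      by (intro map_cong refl) (simp add: PgV Int_absorb2)
    also have "mset \<dots> = mset (map X0 [0..<l])"
      by (rule eq)
    also have "add_mset S (mset (map X0 [0..<l])) = mset (map (case_nat S X0) [0..<Suc l])"
      by (simp add: upt_conv_Cons map_Suc_upt[symmetric] comp_def del: upt_Suc)
    finally show False using neq by simp
  next
    case False
    then have V_ne: "P i \<inter> V \<noteq> {}" if "i < Suc l" for i
      using sub that by blast
    \<comment> \<open>Every part now meets \<open>V\<close>, so by \<open>mixed_S\<close> two
      vertices of \<open>S\<close> never share a part.\<close>
    obtain x x' where x: "x \<in> S" "x' \<in> S" "x \<noteq> x'"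
      using \<open>2 \<le> card S\<close> finS by (metis One_nat_def card_le_Suc0_iff_eq not_less_eq_eq numeral_2_eq_2)
    obtain k where k: "k < Suc l" "x \<in> P k"
      using is_partition_ex1[OF part, of x] x by blast
    obtain m where m: "m < Suc l" "x' \<in> P m"
      using is_partition_ex1[OF part, of x'] x by blast
    obtain y where y: "y \<in> P k \<inter> V" using V_ne[OF k(1)] by auto
    obtain y' where y': "y' \<in> P m \<inter> V" using V_ne[OF m(1)] by auto
    have "k \<noteq> m" using mixed_S[OF k(1), of x x' y] k m x y by auto
    have PkV: "P k \<inter> V = {y}" using mixed_V[OF k(1)] k x y by blast
    have PmV: "P m \<inter> V = {y'}" using mixed_V[OF m(1)] m x y' by blast
    obtain g where g: "bij_betw g {0..<l} ({0..<Suc l} - {k})"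
      using bij[OF k(1)] by blast
    define Q where "Q i = (P i \<inter> V) \<union> (if i = m then P k \<inter> V else {})" for i
    \<comment> \<open>Two vertices span at most one non-edge, so the merged partition is subject to
      (ARS4), yet \<open>Q m\<close> is smaller than every part of \<open>X0\<close>.\<close>
    have Qm: "Q m = {y', y}" unfolding Q_def using PkV PmV by auto
    have eq: "mset (map (Q \<circ> g) [0..<l]) = mset (map X0 [0..<l])"
      using main[OF k(1) m(1) \<open>k \<noteq> m\<close> g Q_def] Qm card_nonedges_doubleton by simp
    have "m \<in> g ` {0..<l}" using g m \<open>k \<noteq> m\<close> by (auto simp: bij_betw_def)
    then obtain i where "i < l" "g i = m" by auto
    then have "3 \<le> card (Q m)" using large[OF eq, of i] by simp
    moreover have "card (Q m) \<le> 2" unfolding Qm by (simp add: card_insert_if)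
    ultimately show False by simp
  qed
qed

end

lemma large_ARS_graph_Suc:
  assumes "large_ARS_graph l V E"
  shows "\<exists>V' E'. large_ARS_graph (Suc l) V' E'"
proof -
  obtain X0 where X0: "ARS3 l V E X0" "ARS4 l V E X0" "\<forall>i<l. 3 \<le> card (X0 i)"
    and g: "simple_graph V E" "ARS1 l V E" "ARS2 l V E"
    using assms unfolding large_ARS_graph_def by blast
  have l: "2 \<le> l" using X0(1) unfolding ARS3_def by simp
  have "infinite (- V)"
    using g(1) unfolding simple_graph_def by simp
  \<comment> \<open>Size 3 keeps the bound on the parts, provides the two vertices of
    \<open>S\<close> used in \<open>ARS4_Suc\<close>, and stays within \<open>Suc l\<close> for
    \<open>ARS1_Suc\<close>, as \<open>l\<close> is at least 2.\<close>
  then obtain S where S: "finite S" "card S = 3" "S \<subseteq> - V"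
    using infinite_arbitrarily_large by blast
  interpret disjoint_clique V E S
    using g(1) S by unfold_locales auto
  have "\<forall>i<Suc l. 3 \<le> card (case_nat S X0 i)"
    using X0(3) S(2) by (auto simp: less_Suc_eq_0_disj)
  then have "large_ARS_graph (Suc l) (V \<union> S) E'"
    using simple_graph_add_clique ARS1_Suc[OF g(2)] ARS2_Suc[OF g(3)] ARS3_Suc[OF X0(1)]
      ARS4_Suc[OF X0(2,3)] S(2) l
    unfolding large_ARS_graph_def by (intro conjI exI[of _ "case_nat S X0"]) auto
  then show ?thesis by blast
qed

subsection \<open>Uniqueness by backtracking\<close>

text \<open>The new non-edges are exactly those at \<open>x\<close>; this is the bookkeeping behind
  one search step.\<close>

lemma card_nonedges_insert:
  assumes sym: "\<And>x y. E x y \<Longrightarrow> E y x" and "finite X" "x \<notin> X"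
  shows "card (nonedges E (insert x X)) = card {y \<in> X. \<not> E x y} + card (nonedges E X)"
proof -
  have split: "nonedges E (insert x X) = (\<lambda>y. {x, y}) ` {y \<in> X. \<not> E x y} \<union> nonedges E X"
    using sym \<open>x \<notin> X\<close> unfolding nonedges_def by (auto simp: insert_commute)
  have "card ((\<lambda>y. {x, y}) ` {y \<in> X. \<not> E x y}) = card {y \<in> X. \<not> E x y}"
    by (rule card_image) (auto simp: inj_on_def doubleton_eq_iff)
  moreover have "(\<lambda>y. {x, y}) ` {y \<in> X. \<not> E x y} \<inter> nonedges E X = {}"
    using \<open>x \<notin> X\<close> unfolding nonedges_def by (auto simp: doubleton_eq_iff)
  ultimately show ?thesis
    unfolding split using \<open>finite X\<close> by (subst card_Un_disjoint) (auto simp: finite_nonedges)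
qed

text \<open>For the backtracking, a set \<open>X\<close> of vertices below \<open>v\<close> is represented by its characteristic
  vector, listed from \<open>v - 1\<close> down to \<open>0\<close>, together with a flag telling whether \<open>X\<close> contains a
  non-edge. A vertex is represented by the vector of its non-neighbours among the smaller vertices.
  Bit vectors keep the evaluation by rewriting fast.\<close>

definition mask :: "nat set \<Rightarrow> nat \<Rightarrow> bool list" where
  "mask X v = map (\<lambda>w. w \<in> X) (rev [0..<v])"

definition row :: "(nat \<Rightarrow> nat \<Rightarrow> bool) \<Rightarrow> nat \<Rightarrow> bool list" where
  "row E v = map (\<lambda>w. \<not> E v w) (rev [0..<v])"

definition part_state :: "(nat \<Rightarrow> nat \<Rightarrow> bool) \<Rightarrow> nat \<Rightarrow> nat set \<Rightarrow> bool \<times> bool list" where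
  "part_state E v X = (card (nonedges E (X \<inter> {..<v})) = 1, mask X v)"

text \<open>Flag of a part after it receives the vertex with row \<open>r\<close>. Positions where
  both vectors are true are its non-neighbours in the part; \<open>None\<close> signals a second
  non-edge.\<close>

fun hit :: "bool \<Rightarrow> bool list \<Rightarrow> bool list \<Rightarrow> bool option" where
  "hit c (a # r) (b # m) = (if a \<and> b then (if c then None else hit True r m) else hit c r m)"
| "hit c _ _ = Some c"

definition skip :: "bool \<times> bool list \<Rightarrow> bool \<times> bool list" where
  "skip s = (fst s, False # snd s)"

text \<open>All states reached by putting the current vertex into a part already open without
  creating a second non-edge there.\<close>

fun placements :: "bool list \<Rightarrow> (bool \<times> bool list) list \<Rightarrow> (bool \<times> bool list) list list" where
  "placements r [] = []"
| "placements r (s # st) =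
     (case hit (fst s) r (snd s) of None \<Rightarrow> [] | Some c \<Rightarrow> [(c, True # snd s) # map skip st]) @
     map ((#) (skip s)) (placements r st)"

text \<open>Depth-first search asserting that every surviving leaf equals \<open>sol\<close>. A new
  part is opened only at the end of the list, so each unordered partition is met once, with parts
  ordered by least vertex; empty parts are never opened.\<close>

fun search :: "nat \<Rightarrow> bool list list \<Rightarrow> (bool \<times> bool list) list \<Rightarrow> bool list list \<Rightarrow> bool" where
  "search l sol st [] \<longleftrightarrow> map snd st = sol"
| "search l sol st (r # rs) \<longleftrightarrow>
     (\<forall>st'\<in>set (placements r st). search l sol st' rs) \<and>
     (length st < l \<longrightarrow> search l sol (map skip st @ [(False, True # map (\<lambda>_. False) r)]) rs)"

section \<open>Correctness of the backtracking\<close>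

lemma mask_eq_imp: "mask X n = mask Y n \<Longrightarrow> X \<subseteq> {..<n} \<Longrightarrow> Y \<subseteq> {..<n} \<Longrightarrow> X = Y"
  unfolding mask_def by auto

lemma hit_map:
  "hit c (map f ws) (map g ws) =
     (if length (filter (\<lambda>w. f w \<and> g w) ws) + of_bool c \<le> 1
      then Some (length (filter (\<lambda>w. f w \<and> g w) ws) + of_bool c = 1) else None)"
  by (induction ws arbitrary: c) auto

lemma part_state_skip: "v \<notin> X \<Longrightarrow> part_state E (Suc v) X = skip (part_state E v X)"
  unfolding part_state_def skip_def mask_def by (simp add: lessThan_Suc)

text \<open>By \<open>card_nonedges_insert\<close> the number of non-edges grows by the number of
  true positions common to row and mask; the bound on the result keeps \<open>hit\<close> from
  failing.\<close>

lemma part_state_hit: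
  assumes sym: "\<And>x y. E x y \<Longrightarrow> E y x" and "v \<in> X" "card (nonedges E (X \<inter> {..<Suc v})) \<le> 1"
  shows "hit (fst (part_state E v X)) (row E v) (snd (part_state E v X)) = Some (fst (part_state E (Suc v) X))"
    and "snd (part_state E (Suc v) X) = True # snd (part_state E v X)"
proof -
  have "X \<inter> {..<Suc v} = insert v (X \<inter> {..<v})"
    using \<open>v \<in> X\<close> by (auto simp: less_Suc_eq)
  then have split: "card (nonedges E (X \<inter> {..<Suc v})) =
      card {w \<in> X \<inter> {..<v}. \<not> E v w} + card (nonedges E (X \<inter> {..<v}))"
    using card_nonedges_insert[of E "X \<inter> {..<v}" v] sym by simp
  have "length (filter (\<lambda>w. \<not> E v w \<and> w \<in> X) (rev [0..<v])) =
      card (set (filter (\<lambda>w. \<not> E v w \<and> w \<in> X) (rev [0..<v])))"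
    by (rule distinct_card[symmetric]) simp
  also have "set (filter (\<lambda>w. \<not> E v w \<and> w \<in> X) (rev [0..<v])) = {w \<in> X \<inter> {..<v}. \<not> E v w}"
    by auto
  finally have len: "length (filter (\<lambda>w. \<not> E v w \<and> w \<in> X) (rev [0..<v])) = card {w \<in> X \<inter> {..<v}. \<not> E v w}" .
  \<comment> \<open>The old count is 0 or 1, so the flag determines it.\<close>
  have flag: "card (nonedges E (X \<inter> {..<v})) = of_bool (card (nonedges E (X \<inter> {..<v})) = 1)"
    using split assms(3) by (cases "card (nonedges E (X \<inter> {..<v}))") auto
  show "hit (fst (part_state E v X)) (row E v) (snd (part_state E v X)) = Some (fst (part_state E (Suc v) X))"
    unfolding part_state_def row_def mask_def fst_conv snd_conv hit_map len
    using split assms(3) flag by metis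
  show "snd (part_state E (Suc v) X) = True # snd (part_state E v X)"
    using \<open>v \<in> X\<close> by (simp add: part_state_def mask_def)
qed

lemma placements_update:
  assumes "k < length st" "hit (fst (st ! k)) r (snd (st ! k)) = Some c"
  shows "(map skip st)[k := (c, True # snd (st ! k))] \<in> set (placements r st)"
  using assms by (induction st arbitrary: k) (auto simp: less_Suc_eq_0_disj)

text \<open>The list \<open>ks\<close> records the indices of the parts met so far, in the order of their first vertices.\<close>

lemma search_complete:
  assumes sym: "\<And>x y. E x y \<Longrightarrow> E y x" and part: "is_partition {..<n} l P"
    and few: "\<forall>i<l. card (nonedges E (P i)) \<le> 1"
  assumes "search l sol (map (\<lambda>i. part_state E v (P i)) ks) (map (row E) [v..<n])" "v \<le> n"
    and "distinct ks" "set ks \<subseteq> {..<l}" "\<forall>u<v. \<exists>i\<in>set ks. u \<in> P i"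
  shows "\<exists>ks. distinct ks \<and> set ks \<subseteq> {..<l} \<and> map (\<lambda>i. mask (P i) n) ks = sol"
  using assms(4-)
proof (induction "n - v" arbitrary: v ks)
  case 0
  then show ?case by (intro exI[of _ ks]) (auto simp: part_state_def comp_def)
next
  case (Suc d)
  then have v: "v < n" "d = n - Suc v" by auto
  have fin: "finite (P i)" if "i < l" for i
    using part that unfolding is_partition_def by (meson finite_lessThan finite_subset)
  obtain i where i: "i < l" "v \<in> P i"
    using is_partition_ex1[OF part, of v] v by auto
  have uniq: "j = i" if "j < l" "u \<in> P i" "u \<in> P j" for j u
    using part i(1) that unfolding is_partition_def by blast
  have search: "search l sol (map (\<lambda>i. part_state E v (P i)) ks) (row E v # map (row E) [Suc v..<n])"
    using Suc.prems(1) v by (simp add: upt_conv_Cons)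
  have few': "card (nonedges E (P i \<inter> {..<Suc v})) \<le> 1"
    using few i card_nonedges_mono[OF fin[OF i(1)], of "P i \<inter> {..<Suc v}" E] by fastforce
  have skipped: "part_state E (Suc v) (P j) = skip (part_state E v (P j))" if "j \<in> set ks" "j \<noteq> i" for j
    using uniq[of j v] that i Suc.prems(4) by (intro part_state_skip) auto
  show ?case
  proof (cases "i \<in> set ks")
    \<comment> \<open>The part of \<open>v\<close> is already open: this is the branch of
      \<open>placements\<close> that updates position \<open>k\<close>.\<close>
    case True
    then obtain k where k: "k < length ks" "ks ! k = i"
      by (metis in_set_conv_nth)
    let ?st = "map (\<lambda>i. part_state E v (P i)) ks"
    have "(map skip ?st)[k := (fst (part_state E (Suc v) (P i)), True # snd (?st ! k))]
        = map (\<lambda>i. part_state E (Suc v) (P i)) ks"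
    proof (rule nth_equalityI)
      fix k' assume k': "k' < length ((map skip ?st)[k := (fst (part_state E (Suc v) (P i)), True # snd (?st ! k))])"
      show "(map skip ?st)[k := (fst (part_state E (Suc v) (P i)), True # snd (?st ! k))] ! k' =
          map (\<lambda>i. part_state E (Suc v) (P i)) ks ! k'"
      proof (cases "k' = k")
        case True
        then show ?thesis
          using k part_state_hit(2)[OF sym i(2) few'] by (simp add: prod_eq_iff)
      next
        case False
        then have "ks ! k' \<noteq> i"
          using k k' Suc.prems(3) by (auto simp: nth_eq_iff_index_eq)
        then show ?thesis using k' False skipped[of "ks ! k'"] by simp
      qed
    qed simp
    moreover have "(map skip ?st)[k := (fst (part_state E (Suc v) (P i)), True # snd (?st ! k))]
        \<in> set (placements (row E v) ?st)"
      using k part_state_hit(1)[OF sym i(2) few'] by (intro placements_update) auto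
    ultimately have "search l sol (map (\<lambda>i. part_state E (Suc v) (P i)) ks) (map (row E) [Suc v..<n])"
      using search by auto
    then show ?thesis
      using Suc.prems True i v by (intro Suc.hyps(1)[of "Suc v" ks]) (auto simp: less_Suc_eq)
  next
    \<comment> \<open>\<open>v\<close> is the least vertex of its part, so the branch opening a new
      part applies; fewer than \<open>l\<close> parts are open because \<open>i\<close> is missing
      from \<open>ks\<close>.\<close>
    case False
    have "card (insert i (set ks)) \<le> card {..<l}"
      using Suc.prems(4) i by (intro card_mono) auto
    then have "length ks < l"
      using False Suc.prems(3) by (simp add: distinct_card)
    moreover have empty: "P i \<inter> {..<v} = {}"
    proof (rule ccontr)
      assume "P i \<inter> {..<v} \<noteq> {}"
      then obtain u j where "u \<in> P i" "j \<in> set ks" "u \<in> P j"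
        using Suc.prems(5) by blast
      then show False using uniq[of j u] Suc.prems(4) False by auto
    qed
    have "part_state E (Suc v) (P i) = (False, True # map (\<lambda>_. False) (row E v))"
    proof -
      have "P i \<inter> {..<Suc v} = {v}" using empty i by (auto simp: less_Suc_eq)
      moreover have "nonedges E {v} = {}" unfolding nonedges_def by auto
      moreover have "mask (P i) v = map (\<lambda>_. False) (row E v)"
        using empty unfolding mask_def row_def by auto
      ultimately show ?thesis using i unfolding part_state_def by (simp add: mask_def)
    qed
    moreover have "map skip (map (\<lambda>i. part_state E v (P i)) ks) = map (\<lambda>i. part_state E (Suc v) (P i)) ks"
      using skipped False by (auto intro!: skipped[symmetric])
    ultimately have "search l sol (map (\<lambda>i. part_state E (Suc v) (P i)) (ks @ [i])) (map (row E) [Suc v..<n])"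
      using search by (auto simp del: map_map)
    then show ?thesis
      using Suc.prems False i v by (intro Suc.hyps(1)[of "Suc v" "ks @ [i]"]) (auto simp: less_Suc_eq)
  qed
qed

text \<open>The search lists parts by least vertex, \<open>X0\<close> in the order of (ARS3); hence
  the link by multisets. As \<open>Xs\<close> has \<open>l\<close> entries, the indices found by the
  search exhaust \<open>{..<l}\<close>.\<close>

lemma ARS4_search:
  assumes sym: "\<And>x y. E x y \<Longrightarrow> E y x"
    and search: "search l (map (\<lambda>X. mask (set X) n) Xs) [] (map (row E) [0..<n])"
    and Xs: "length Xs = l" "\<forall>X\<in>set Xs. set X \<subseteq> {..<n}"
    and X0: "mset (map X0 [0..<l]) = mset (map set Xs)"
  shows "ARS4 l {..<n} E X0"
  unfolding ARS4_def
proof (intro allI impI, elim conjE, rule ccontr)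
  fix P
  assume part: "is_partition {..<n} l P"
    and neq: "mset (map P [0..<l]) \<noteq> mset (map X0 [0..<l])"
    and "\<not> (\<exists>i<l. 2 \<le> card (nonedges E (P i)))"
  then have few: "\<forall>i<l. card (nonedges E (P i)) \<le> 1" by force
  have PV: "P i \<subseteq> {..<n}" if "i < l" for i
    using part that unfolding is_partition_def by auto
  obtain ks where ks: "distinct ks" "set ks \<subseteq> {..<l}"
      "map (\<lambda>i. mask (P i) n) ks = map (\<lambda>X. mask (set X) n) Xs"
    using search_complete[OF sym part few, of _ 0 "[]"] search by auto
  have len: "length ks = l"
    using ks(3) Xs(1) by (metis length_map)
  have "map P ks = map set Xs"
  proof (rule nth_equalityI)
    fix k assume k: "k < length (map P ks)"
    then have "mask (P (ks ! k)) n = mask (set (Xs ! k)) n"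
      using ks(3) len Xs(1) by (metis length_map nth_map)
    moreover have "P (ks ! k) \<subseteq> {..<n}"
      using k ks(2) PV by (metis length_map lessThan_iff nth_mem subsetD)
    moreover have "set (Xs ! k) \<subseteq> {..<n}"
      using k len Xs by simp
    ultimately show "map P ks ! k = map set Xs ! k"
      using k len Xs(1) mask_eq_imp by simp
  qed (use len Xs in simp)
  moreover have "set ks = {..<l}"
    using ks(1,2) len by (intro card_subset_eq) (auto simp: distinct_card)
  then have "mset ks = mset [0..<l]"
    using ks(1) by (metis atLeast_upt distinct_upt set_eq_iff_mset_eq_distinct)
  ultimately have "mset (map P [0..<l]) = mset (map set Xs)"
    by (metis mset_map)
  then show False using neq X0 by simp
qed

subsection \<open>A graph for four parts\<close>

lemma distinct_concat_nth_disjoint: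
  "distinct (concat Ps) \<Longrightarrow> i < j \<Longrightarrow> j < length Ps \<Longrightarrow> set (Ps ! i) \<inter> set (Ps ! j) = {}"
proof (induction Ps arbitrary: i j)
  case (Cons X Ps)
  obtain j' where j: "j = Suc j'" using Cons.prems(2) by (cases j) auto
  show ?case
  proof (cases i)
    case 0
    have "set (Ps ! j') \<subseteq> set (concat Ps)"
      using Cons.prems(3) j nth_mem[of j' Ps] by fastforce
    then show ?thesis using Cons.prems(1) 0 j by auto
  next
    case (Suc i')
    then show ?thesis using Cons.IH[of i' j'] Cons.prems j by auto
  qed
qed simp

lemma is_partition_nth:
  assumes "distinct (concat Ps)" "length Ps = l" "set (concat Ps) = V"
  shows "is_partition V l (\<lambda>i. set (Ps ! i))"
proof (rule is_partitionI)
  show "set (Ps ! i) \<subseteq> V" if "i < l" for i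
    using that assms by (auto intro: nth_mem)
  show "\<exists>i<l. x \<in> set (Ps ! i)" if "x \<in> V" for x
  proof -
    obtain X where "X \<in> set Ps" "x \<in> set X" using assms(3) \<open>x \<in> V\<close> by auto
    then show ?thesis using assms(2) by (metis in_set_conv_nth)
  qed
  show "i = j" if "i < l" "j < l" "x \<in> set (Ps ! i)" "x \<in> set (Ps ! j)" for i j x
  proof (rule ccontr)
    assume "i \<noteq> j"
    then have "set (Ps ! i) \<inter> set (Ps ! j) = {}"
      using distinct_concat_nth_disjoint[OF assms(1)] assms(2) that(1,2)
      by (metis Int_commute linorder_neqE_nat)
    then show False using that(3,4) by auto
  qed
qed

text \<open>Reduces (ARS1) for one \<open>s\<close> to conditions on lists that evaluation
  decides.\<close>

lemma ARS1_witness: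
  assumes "distinct (concat Ps)" "length Ps = l" "set (concat Ps) = V"
    and "\<forall>X\<in>set (take s Ps). is_stable E (set X)" "\<forall>X\<in>set (drop s Ps). is_clique E (set X)"
  shows "\<exists>P. is_partition V l P \<and> (\<forall>i<s. i < l \<longrightarrow> is_stable E (P i)) \<and>
    (\<forall>i. s \<le> i \<and> i < l \<longrightarrow> is_clique E (P i))"
proof (intro exI conjI allI impI)
  show "is_partition V l (\<lambda>i. set (Ps ! i))"
    using assms(1-3) by (rule is_partition_nth)
  show "is_stable E (set (Ps ! i))" if "i < s" "i < l" for i
    using that assms(2,4) by (metis in_set_conv_nth length_take min_less_iff_conj nth_take)
  show "is_clique E (set (Ps ! i))" if "s \<le> i \<and> i < l" for i
  proof -
    have "Ps ! i = drop s Ps ! (i - s)" "i - s < length (drop s Ps)"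
      using that assms(2) by auto
    then show ?thesis using assms(5) by (metis nth_mem)
  qed
qed

lemma ARS2_witness:
  assumes "distinct (concat (Ps @ [X]))" "length Ps = l - 1" "0 < l" "set (concat (Ps @ [X])) = V"
    and "\<forall>X\<in>set Ps. is_clique E (set X)" "F E (set X)"
  shows "\<exists>P. is_partition V l P \<and> (\<forall>i. i < l - 1 \<longrightarrow> is_clique E (P i)) \<and> F E (P (l - 1))"
proof (intro exI conjI allI impI)
  show "is_partition V l (\<lambda>i. set ((Ps @ [X]) ! i))"
    using assms(1-4) by (intro is_partition_nth) auto
  show "is_clique E (set ((Ps @ [X]) ! i))" if "i < l - 1" for i
    using that assms(2,5) by (simp add: nth_append)
  show "F E (set ((Ps @ [X]) ! (l - 1)))"
    using assms(2,6) by (simp add: nth_append)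
qed

text \<open>The embedding sends \<open>xs ! i\<close> to \<open>i\<close>, so the order of
  \<open>xs\<close> has to match the numbering of the vertices of the target graph.\<close>

lemma induced_in_set:
  assumes "distinct xs" "{..<length xs} \<subseteq> VJ"
    and "\<forall>i<length xs. \<forall>j<length xs. E (xs ! i) (xs ! j) \<longleftrightarrow> EJ i j"
  shows "induced_in E (set xs) VJ EJ"
proof -
  define f where "f = the_inv_into {..<length xs} ((!) xs)"
  have inj: "inj_on ((!) xs) {..<length xs}"
    using assms(1) by (simp add: inj_on_nth)
  have im: "(!) xs ` {..<length xs} = set xs"
    by (auto simp: set_conv_nth)
  have bij: "bij_betw f (set xs) {..<length xs}"
    unfolding f_def using inj im by (intro bij_betw_the_inv_into) (auto simp: bij_betw_def)
  have "xs ! f x = x" if "x \<in> set xs" for x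
    unfolding f_def using f_the_inv_into_f[OF inj] that im by auto
  then show ?thesis
    unfolding induced_in_def using assms(2,3) bij bij_betwE[OF bij]
    by (intro exI[of _ f]) (auto simp: bij_betw_def, metis+)
qed

text \<open>The graph was found by a computer search with a SAT solver. Its vertices are numbered so that the
  search tree in \<open>base_search\<close> is small.\<close>

definition base_adj :: "nat list list" where
  "base_adj =
    [[5, 7, 12, 14], [2, 8, 10, 11, 13], [1, 11, 12], [4, 12, 13, 14], [3, 7, 9, 10, 11, 12, 13],
     [0, 6, 10, 11, 12, 13, 14], [5, 8, 9, 14], [0, 4, 9, 10, 11, 13, 14], [1, 6, 9, 10, 13],
     [4, 6, 7, 8, 11], [1, 4, 5, 7, 8, 13, 14], [1, 2, 4, 5, 7, 9], [0, 2, 3, 4, 5, 13, 14],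
     [1, 3, 4, 5, 7, 8, 10, 12, 14], [0, 3, 5, 6, 7, 10, 12, 13]]"

definition base_edge :: "nat \<Rightarrow> nat \<Rightarrow> bool" where
  "base_edge x y \<longleftrightarrow> x < 15 \<and> y \<in> set (base_adj ! x)"

text \<open>Ordered as (ARS3) demands: the two cliques first, then the two parts with a single
  non-edge, \<open>{2, 3}\<close> and \<open>{0, 6}\<close>.\<close>

definition base_parts :: "nat list list" where
  "base_parts = [[11, 9, 7, 4], [13, 10, 8, 1], [12, 3, 2], [14, 6, 5, 0]]"

section \<open>Verification of the base graph\<close>

lemma length_base_parts: "length base_parts = 4"
  by (simp add: base_parts_def)

text \<open>The parts of \<open>base_parts\<close>, rearranged by least vertex as the search
  produces them, form the only leaf that can survive.\<close>

lemma base_search: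
  "search 4 (map (\<lambda>X. mask (set X) 15) [[14, 6, 5, 0], [13, 10, 8, 1], [12, 3, 2], [11, 9, 7, 4]])
     [] (map (row base_edge) [0..<15])"
  by code_simp

lemma base_edge_sym: "base_edge x y \<Longrightarrow> base_edge y x"
proof -
  have "\<forall>x\<in>set [0..<15]. \<forall>y\<in>set (base_adj ! x). base_edge y x"
    by code_simp
  then show "base_edge x y \<Longrightarrow> base_edge y x" unfolding base_edge_def[of x y] by auto
qed

lemma base_simple_graph: "simple_graph (set [0..<15]) base_edge"
proof -
  have "\<forall>x\<in>set [0..<15]. \<forall>y\<in>set (base_adj ! x). y < 15 \<and> x \<noteq> y"
    by code_simp
  then have "x < 15 \<and> y < 15 \<and> x \<noteq> y" if "base_edge x y" for x y
    using that unfolding base_edge_def by auto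
  then show ?thesis
    using base_edge_sym unfolding simple_graph_def by auto
qed

lemma base_ARS1: "ARS1 4 (set [0..<15]) base_edge"
  unfolding ARS1_def
proof (intro allI impI)
  fix s :: nat assume s: "1 \<le> s \<and> s \<le> 4"
  have "\<exists>Ps. distinct (concat Ps) \<and> length Ps = 4 \<and> set (concat Ps) = set [0..<15] \<and>
    (\<forall>X\<in>set (take s Ps). is_stable base_edge (set X)) \<and> (\<forall>X\<in>set (drop s Ps). is_clique base_edge (set X))"
  proof -
    consider "s = 1" | "s = 2" | "s = 3" | "s = 4" using s by linarith
    then show ?thesis
    proof cases
      case 1
      show ?thesis unfolding 1 is_stable_def is_clique_def
        \<comment> \<open>In each of the four witnesses the first \<open>s\<close> lists are the
          stable sets and the others the cliques.\<close>
        by (rule exI[of _ "[[0, 2, 3, 6, 10], [1, 8, 13], [4, 7, 9, 11], [5, 12, 14]]"]) code_simp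
    next
      case 2
      show ?thesis unfolding 2 is_stable_def is_clique_def
        by (rule exI[of _ "[[0, 2, 3, 8], [1, 6, 7, 12], [4, 9, 11], [5, 10, 13, 14]]"]) code_simp
    next
      case 3
      show ?thesis unfolding 3 is_stable_def is_clique_def
        by (rule exI[of _ "[[0, 1, 3, 9], [2, 4, 5, 8], [6, 10, 11, 12], [7, 13, 14]]"]) code_simp
    next
      case 4
      show ?thesis unfolding 4 is_stable_def is_clique_def
        by (rule exI[of _ "[[0, 2, 9, 13], [1, 3, 5, 7], [4, 8, 14], [6, 10, 11, 12]]"]) code_simp
    qed
  qed
  then obtain Ps where "distinct (concat Ps)" "length Ps = 4" "set (concat Ps) = set [0..<15]"
    "\<forall>X\<in>set (take s Ps). is_stable base_edge (set X)" "\<forall>X\<in>set (drop s Ps). is_clique base_edge (set X)"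
    by blast
  from ARS1_witness[OF this] s
  show "\<exists>P. is_partition (set [0..<15]) 4 P \<and> (\<forall>i<s. is_stable base_edge (P i)) \<and>
      (\<forall>i. s \<le> i \<and> i < 4 \<longrightarrow> is_clique base_edge (P i))"
    by (meson order_less_le_trans)
qed

lemma base_K1_or_C: "fam_K1_or_C base_edge (set [3, 6, 8, 9])"
proof -
  have "induced_in base_edge (set [3]) K1_V K1_E"
    by (rule induced_in_set) (auto simp: K1_V_def K1_E_def base_edge_def base_adj_def)
  moreover have "is_clique base_edge (set [6, 8, 9])" "\<forall>a\<in>set [3]. \<forall>b\<in>set [6, 8, 9]. \<not> base_edge a b"
    unfolding is_clique_def by code_simp+
  ultimately show ?thesis
    unfolding fam_K1_or_C_def in_disj_union_def by (intro exI[of _ "set [3]"] exI[of _ "set [6, 8, 9]"]) auto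
qed

lemma base_S3_and_C: "fam_S3_and_C base_edge (set [2, 3, 6])"
proof -
  have "\<forall>i<length [2, 3, 6::nat]. \<forall>j<length [2, 3, 6::nat].
      base_edge ([2, 3, 6] ! i) ([2, 3, 6] ! j) \<longleftrightarrow> S3_E i j"
    by code_simp
  then have "induced_in base_edge (set [2, 3, 6]) S3_V S3_E"
    by (intro induced_in_set) (auto simp: S3_V_def)
  then show ?thesis
    unfolding fam_S3_and_C_def in_join_def
    \<comment> \<open>The three vertices are already stable; the complete graph of the join is
      empty.\<close>
    by (intro exI[of _ "set [2, 3, 6]"] exI[of _ "{}"]) (auto simp: is_clique_def)
qed

lemma base_C4_and_C: "fam_C4_and_C base_edge (set [0, 5, 7, 10, 14])"
proof -
  \<comment> \<open>The cycle is listed in cyclic order to match \<open>C4_E\<close>; vertex 14 is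
    adjacent to all of it.\<close>
  have "\<forall>i<length [0, 5, 10, 7::nat]. \<forall>j<length [0, 5, 10, 7::nat].
      base_edge ([0, 5, 10, 7] ! i) ([0, 5, 10, 7] ! j) \<longleftrightarrow> C4_E i j"
    by code_simp
  then have "induced_in base_edge (set [0, 5, 10, 7]) C4_V C4_E"
    by (intro induced_in_set) (auto simp: C4_V_def)
  moreover have "is_clique base_edge (set [14])" "\<forall>a\<in>set [0, 5, 10, 7]. \<forall>b\<in>set [14]. base_edge a b"
    unfolding is_clique_def by code_simp+
  ultimately show ?thesis
    unfolding fam_C4_and_C_def in_join_def by (intro exI[of _ "set [0, 5, 10, 7]"] exI[of _ "set [14]"]) auto
qed

lemma base_coP3_and_C: "fam_coP3_and_C base_edge (set [3, 4, 7, 10, 13])"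
proof -
  \<comment> \<open>\<open>coP3_E\<close> has its edge between 0 and 2, so the isolated vertex 3
    must stand in the middle.\<close>
  have "\<forall>i<length [7, 3, 10::nat]. \<forall>j<length [7, 3, 10::nat].
      base_edge ([7, 3, 10] ! i) ([7, 3, 10] ! j) \<longleftrightarrow> coP3_E i j"
    by code_simp
  then have "induced_in base_edge (set [7, 3, 10]) coP3_V coP3_E"
    by (intro induced_in_set) (auto simp: coP3_V_def)
  moreover have "is_clique base_edge (set [4, 13])" "\<forall>a\<in>set [7, 3, 10]. \<forall>b\<in>set [4, 13]. base_edge a b"
    unfolding is_clique_def by code_simp+
  ultimately show ?thesis
    unfolding fam_coP3_and_C_def in_join_def by (intro exI[of _ "set [7, 3, 10]"] exI[of _ "set [4, 13]"]) auto
qed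

lemma base_ARS2: "ARS2 4 (set [0..<15]) base_edge"
  unfolding ARS2_def
proof (intro ballI)
  fix F assume F: "F \<in> {fam_K1_or_C, fam_S3_and_C, fam_C4_and_C, fam_coP3_and_C}"
  have "\<exists>Ps X. distinct (concat (Ps @ [X])) \<and> length Ps = 4 - 1 \<and> set (concat (Ps @ [X])) = set [0..<15] \<and>
    (\<forall>X\<in>set Ps. is_clique base_edge (set X)) \<and> F base_edge (set X)"
  proof -
    have wit: ?thesis
      if "distinct (concat (Ps @ [X])) \<and> length Ps = 4 - 1 \<and> set (concat (Ps @ [X])) = set [0..<15] \<and>
        (\<forall>X\<in>set Ps. is_clique base_edge (set X))" "F base_edge (set X)" for Ps X
      using that by blast
    consider "F = fam_K1_or_C" | "F = fam_S3_and_C" | "F = fam_C4_and_C" | "F = fam_coP3_and_C"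
      using F by blast
    then show ?thesis
    proof cases
      case 1
      show ?thesis
        by (rule wit[of "[[0, 5, 12, 14], [1, 2, 11], [4, 7, 10, 13]]" "[3, 6, 8, 9]"])
          (unfold is_clique_def 1, code_simp, rule base_K1_or_C)
    next
      case 2
      show ?thesis
        by (rule wit[of "[[0, 5, 12, 14], [1, 8, 10, 13], [4, 7, 9, 11]]" "[2, 3, 6]"])
          (unfold is_clique_def 2, code_simp, rule base_S3_and_C)
    next
      case 3
      show ?thesis
        by (rule wit[of "[[1, 2, 11], [3, 4, 12, 13], [6, 8, 9]]" "[0, 5, 7, 10, 14]"])
          (unfold is_clique_def 3, code_simp, rule base_C4_and_C)
    next
      case 4
      show ?thesis
        by (rule wit[of "[[0, 5, 12, 14], [1, 2, 11], [6, 8, 9]]" "[3, 4, 7, 10, 13]"])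
          (unfold is_clique_def 4, code_simp, rule base_coP3_and_C)
    qed
  qed
  then obtain Ps X where "distinct (concat (Ps @ [X]))" "length Ps = 4 - 1"
    "set (concat (Ps @ [X])) = set [0..<15]" "\<forall>X\<in>set Ps. is_clique base_edge (set X)" "F base_edge (set X)"
    by blast
  then show "\<exists>P. is_partition (set [0..<15]) 4 P \<and> (\<forall>i<4 - 1. is_clique base_edge (P i)) \<and>
      F base_edge (P (4 - 1))"
    by (intro ARS2_witness) auto
qed

lemma nonedges_set_eq:
  assumes "\<forall>x\<in>set xs. \<forall>y\<in>set xs. x \<noteq> y \<and> \<not> E x y \<longrightarrow> x = a \<and> y = b \<or> x = b \<and> y = a"
    and "a \<in> set xs" "b \<in> set xs" "a \<noteq> b" "\<not> E a b"
  shows "nonedges E (set xs) = {{a, b}}"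
proof
  show "nonedges E (set xs) \<subseteq> {{a, b}}"
    using assms(1) unfolding nonedges_def by (auto simp: doubleton_eq_iff)
  show "{{a, b}} \<subseteq> nonedges E (set xs)"
    using assms(2-) unfolding nonedges_def by blast
qed

lemma base_ARS3: "ARS3 4 (set [0..<15]) base_edge (\<lambda>i. set (base_parts ! i))"
proof -
  have "is_partition (set [0..<15]) 4 (\<lambda>i. set (base_parts ! i))"
    by (rule is_partition_nth) code_simp+
  moreover have "\<forall>i<2. is_clique base_edge (set (base_parts ! i))"
    unfolding is_clique_def by code_simp
  moreover have "nonedges base_edge (set (base_parts ! 2)) = {{2, 3}}"
    by (rule nonedges_set_eq) code_simp+
  moreover have "nonedges base_edge (set (base_parts ! 3)) = {{0, 6}}"
    by (rule nonedges_set_eq) code_simp+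
  moreover have "is_stable base_edge (set [2, 3, 0, 6])"
    unfolding is_stable_def by code_simp
  ultimately show ?thesis
    unfolding ARS3_def by auto
qed

lemma base_ARS4: "ARS4 4 (set [0..<15]) base_edge (\<lambda>i. set (base_parts ! i))"
  unfolding atLeast_upt[symmetric] using base_edge_sym base_search
proof (rule ARS4_search)
  \<comment> \<open>\<open>base_parts\<close> and the list in \<open>base_search\<close> differ by
    exchanging the first and the last part.\<close>
  have swap: "mset [a, b, c, d] = mset [d, b, c, a]" for a b c d :: "nat set"
    by (simp add: add_mset_commute)
  have "map (\<lambda>i. set (base_parts ! i)) [0..<4] = map set base_parts"
    by (rule nth_equalityI) (simp_all add: length_base_parts)
  then show "mset (map (\<lambda>i. set (base_parts ! i)) [0..<4]) =
      mset (map set [[14, 6, 5, 0], [13, 10, 8, 1], [12, 3, 2], [11, 9, 7, 4]])"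
    by (simp only: base_parts_def list.map swap)
qed auto

lemma base_large_ARS_graph: "large_ARS_graph 4 (set [0..<15]) base_edge"
proof -
  have "\<forall>i<4. 3 \<le> card (set (base_parts ! i))"
    by code_simp
  then show ?thesis
    using base_simple_graph base_ARS1 base_ARS2 base_ARS3 base_ARS4
    unfolding large_ARS_graph_def by (intro conjI exI[of _ "\<lambda>i. set (base_parts ! i)"])
qed

section \<open>Infinitely many values of \<open>l\<close>\<close>

lemma ex_large_ARS_graph: "\<exists>V E. large_ARS_graph (4 + n) V E"
proof (induction n)
  case 0
  then show ?case using base_large_ARS_graph by auto
next
  case (Suc n)
  then show ?case using large_ARS_graph_Suc by fastforce
qed

theorem theorem3p1:
  shows "infinite {l :: nat. 0 < l \<and> (\<exists>V E. ARS_graph l V E)}"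
proof -
  \<comment> \<open>Every \<open>l \<ge> 4\<close> is reached from the base graph by adding
    triangles.\<close>
  have "\<exists>V E. ARS_graph l V E" if "4 \<le> l" for l
    using ex_large_ARS_graph[of "l - 4"] that unfolding large_ARS_graph_def ARS_graph_def by auto
  then have "{4..} \<subseteq> {l. 0 < l \<and> (\<exists>V E. ARS_graph l V E)}"
    by auto
  then show ?thesis
    using infinite_Ici finite_subset by blast
qed

end
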